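(* Let $I=\langle f_1,\dots,f_r\rangle\subset\mathbb{C}[Z_1,\dots,Z_n]$ with $f_i=\sum_{j=1}^{d_i}b_{ij}Z^{\alpha(i,j)}$, $b_{ij}\in\mathbb{C}^*$, $\alpha(i,j)\in\mathbb{N}_0^n$, and assume that the set $\bigcup_{i=1}^r\bigcup_{j=1}^{d_i}\{\alpha(i,j)\}$ spans $\mathbb{R}^n$. Let $\lambda\in(0,\infty)^n$, let $m_{ij}=Z^{\alpha(i,j)}$ and $\mu_{ij}=\lambda^{\alpha(i,j)}$, and let $I^*\subset\mathbb{R}[X,Y]$ be the ideal generated by $$\{f_i^{\mathrm{re}},f_i^{\mathrm{im}} : 1\le i\le r\}\ \cup\ \{(m_{ij}^{\mathrm{re}})^2+(m_{ij}^{\mathrm{im}})^2-\mu_{ij}^2 : 1\le j\le d_i,\ 1\le i\le r\}.$$ Either $\lambda\in\mathcal{U}_I$, or there exist a polynomial $G\in I^*$ and a sum of squares polynomial $H\in\mathbb{R}[X,Y]$ with $$G+H+1=0 .$$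
   Context: $\mathbb{R}[X,Y]=\mathbb{R}[X_1,\dots,X_n,Y_1,\dots,Y_n]$; $\mathbb{C}^*=\mathbb{C}\setminus\{0\}$. For $\alpha\in\mathbb{N}_0^n$, $Z^\alpha=Z_1^{\alpha_1}\cdots Z_n^{\alpha_n}$ and $\lambda^\alpha=\lambda_1^{\alpha_1}\cdots\lambda_n^{\alpha_n}$. For $f\in\mathbb{C}[Z_1,\dots,Z_n]$, the real and imaginary parts $f^{\mathrm{re}},f^{\mathrm{im}}\in\mathbb{R}[X,Y]$ are defined by $f(X+iY)=f^{\mathrm{re}}(X,Y)+i\,f^{\mathrm{im}}(X,Y)$. $\mathcal{V}(I)\subset\mathbb{C}^n$ is the complex variety of $I$, and the unlog amoeba of $I$ is $\mathcal{U}_I=\{(|z_1|,\dots,|z_n|) : z\in\mathcal{V}(I)\}$. A sum of squares polynomial is a finite sum of squares of polynomials in $\mathbb{R}[X,Y]$. *)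

theory Defs
  imports "HOL-Analysis.Analysis" "HOL-Library.Poly_Mapping"
begin

text \<open>
  Polynomials over \<open>'a\<close> in variables indexed by \<open>'x\<close>: finitely supported maps from exponent
  vectors to coefficients, with the convolution product of Poly_Mapping.
  For a finite type \<open>'n\<close>, \<open>('n, complex) mpoly\<close> is the ring \<open>\<complex>[Z\<^sub>1,\<dots>,Z\<^sub>n]\<close> with \<open>n = CARD('n)\<close>,
  and \<open>('n + 'n, real) mpoly\<close> is \<open>\<real>[X,Y]\<close>, where \<open>X\<^sub>k\<close> is the variable \<open>Inl k\<close> and \<open>Y\<^sub>k\<close> the
  variable \<open>Inr k\<close>.
\<close>

type_synonym 'x expo = "'x \<Rightarrow>\<^sub>0 nat"
type_synonym ('x, 'a) mpoly = "('x \<Rightarrow>\<^sub>0 nat) \<Rightarrow>\<^sub>0 'a"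

definition mconst :: "'a::zero \<Rightarrow> ('x, 'a) mpoly" where
  "mconst c = Poly_Mapping.single 0 c"

definition mvar :: "'x \<Rightarrow> ('x, 'a::zero_neq_one) mpoly" where
  "mvar k = Poly_Mapping.single (Poly_Mapping.single k 1) 1"

definition expo_power :: "('x \<Rightarrow> 'r::comm_monoid_mult) \<Rightarrow> 'x expo \<Rightarrow> 'r" where
  "expo_power g \<alpha> = (\<Prod>k\<in>Poly_Mapping.keys \<alpha>. g k ^ Poly_Mapping.lookup \<alpha> k)"

definition mpoly_subst ::
    "('a::zero \<Rightarrow> 'r::comm_semiring_1) \<Rightarrow> ('x \<Rightarrow> 'r) \<Rightarrow> ('x, 'a) mpoly \<Rightarrow> 'r" where
  "mpoly_subst h g p =
     (\<Sum>\<alpha>\<in>Poly_Mapping.keys p. h (Poly_Mapping.lookup p \<alpha>) * expo_power g \<alpha>)"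

definition mpoly_eval :: "('x \<Rightarrow> 'a::comm_semiring_1) \<Rightarrow> ('x, 'a) mpoly \<Rightarrow> 'a" where
  "mpoly_eval = mpoly_subst (\<lambda>c. c)"

lemma module_times: "module ((*) :: 'a::comm_ring_1 \<Rightarrow> 'a \<Rightarrow> 'a)"
  by unfold_locales (simp_all add: algebra_simps)

text \<open>The ideal generated by \<open>S\<close> is the submodule of the ring (as a module over itself)
  spanned by \<open>S\<close>.\<close>

definition ideal_gen :: "'a::comm_ring_1 set \<Rightarrow> 'a set" where
  "ideal_gen S = module.span (*) S"

lemma ideal_gen_explicit:
  "ideal_gen S = {\<Sum>a\<in>T. c a * a | T c. finite T \<and> T \<subseteq> S}"
  unfolding ideal_gen_def module.span_explicit[OF module_times] by blast

definition variety :: "('n::finite, complex) mpoly set \<Rightarrow> (complex ^ 'n) set" where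
  "variety I = {z. \<forall>f\<in>I. mpoly_eval (\<lambda>k. z $ k) f = 0}"

definition unlog_amoeba :: "('n::finite, complex) mpoly set \<Rightarrow> (real ^ 'n) set" where
  "unlog_amoeba I = {(\<chi> k. cmod (z $ k)) | z. z \<in> variety I}"

definition XY_subst :: "('n, complex) mpoly \<Rightarrow> ('n + 'n, complex) mpoly" where
  "XY_subst = mpoly_subst mconst (\<lambda>k. mvar (Inl k) + mconst \<i> * mvar (Inr k))"

text \<open>\<open>f(X + iY)\<close> is split into its real and imaginary part coefficientwise; this is the unique
  decomposition \<open>f(X + iY) = g + i h\<close> with real polynomials \<open>g\<close> and \<open>h\<close>, see
  \<open>re_im_part_unique\<close> below.\<close>

definition re_part :: "('n, complex) mpoly \<Rightarrow> ('n + 'n, real) mpoly" where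
  "re_part f = Poly_Mapping.map Re (XY_subst f)"

definition im_part :: "('n, complex) mpoly \<Rightarrow> ('n + 'n, real) mpoly" where
  "im_part f = Poly_Mapping.map Im (XY_subst f)"

lemma lookup_map_zero:
  "h 0 = 0 \<Longrightarrow> Poly_Mapping.lookup (Poly_Mapping.map h p) m = h (Poly_Mapping.lookup p m)"
  by (simp add: map.rep_eq when_def)

lemma re_im_part_unique:
  "XY_subst f = Poly_Mapping.map complex_of_real g + mconst \<i> * Poly_Mapping.map complex_of_real h
     \<longleftrightarrow> g = re_part f \<and> h = im_part f"
proof -
  have "Poly_Mapping.lookup
          (Poly_Mapping.map complex_of_real g + mconst \<i> * Poly_Mapping.map complex_of_real h) m
        = Complex (Poly_Mapping.lookup g m) (Poly_Mapping.lookup h m)" for m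
    unfolding mconst_def mult_map_scale_conv_mult[symmetric]
    by (simp add: lookup_add lookup_map_zero complex_eq_iff)
  then show ?thesis
    by (auto simp: poly_mapping_eq_iff fun_eq_iff re_part_def im_part_def
        lookup_map_zero complex_eq_iff)
qed

definition sum_of_squares :: "'a::comm_semiring_1 \<Rightarrow> bool" where
  "sum_of_squares H \<longleftrightarrow> (\<exists>qs. H = (\<Sum>q\<leftarrow>qs. q ^ 2))"

end

theory Submission
  imports Defs
begin

text \<open>
  The exponents span \<open>\<real>\<^sup>n\<close>, so by Cramer's rule some positive multiple of each unit vector is an
  integer combination of them. Since all the constants involved are invertible, the generators of
  \<open>I\<^sup>*\<close> therefore force \<open>(X\<^sub>k\<^sup>2 + Y\<^sub>k\<^sup>2)\<^sup>N = \<lambda>\<^sub>k\<^bsup>2N\<^esup>\<close> modulo \<open>I\<^sup>*\<close> for some \<open>N > 0\<close>.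

  If there is no certificate, the preordering \<open>I\<^sup>* + \<Sigma>\<^sup>2\<close> does not contain \<open>-1\<close> and extends, by Zorn's
  lemma, to a total preordering of \<open>\<real>[X,Y]\<close>. The relations above bound every variable in it, so it
  is Archimedean and taking standard parts is a ring homomorphism to \<open>\<real>\<close>, that is, evaluation at a
  real point. This point is a common zero of \<open>I\<^sup>*\<close> and yields \<open>z \<in> V(I)\<close> with \<open>|z\<^sub>k| = \<lambda>\<^sub>k\<close>. No general
  real Nullstellensatz is needed. Conversely, evaluating a certificate at such a point gives
  \<open>0 + H + 1 = 0\<close> with \<open>H \<ge> 0\<close>.
\<close>

section \<open>Ring homomorphisms\<close>

text \<open>One notion serves for the embedding of constants, substitution, evaluation and the
  standard part map.\<close>

locale unital_ring_hom =
  fixes \<phi> :: "'a::comm_ring_1 \<Rightarrow> 'b::comm_ring_1"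
  assumes hom_one: "\<phi> 1 = 1"
    and hom_add: "\<phi> (a + b) = \<phi> a + \<phi> b"
    and hom_mult: "\<phi> (a * b) = \<phi> a * \<phi> b"
begin

lemma hom_zero: "\<phi> 0 = 0"
  using hom_add[of 0 0] by simp

lemma hom_uminus: "\<phi> (- a) = - \<phi> a"
  using hom_add[of a "- a"] by (simp add: hom_zero eq_neg_iff_add_eq_0 add.commute)

lemma hom_diff: "\<phi> (a - b) = \<phi> a - \<phi> b"
  using hom_add[of a "- b"] by (simp add: hom_uminus)

lemma hom_power: "\<phi> (a ^ n) = \<phi> a ^ n"
  by (induction n) (simp_all add: hom_one hom_mult)

lemma hom_prod: "\<phi> (\<Prod>k\<in>K. g k) = (\<Prod>k\<in>K. \<phi> (g k))"
  by (induction K rule: infinite_finite_induct) (simp_all add: hom_one hom_mult)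

lemma hom_expo_power: "\<phi> (expo_power g \<alpha>) = expo_power (\<lambda>k. \<phi> (g k)) \<alpha>"
  by (simp add: expo_power_def hom_prod hom_power)

end

lemma hom_sum_of_squares_nonneg:
  fixes \<phi> :: "'a::comm_ring_1 \<Rightarrow> real"
  assumes "unital_ring_hom \<phi>" "sum_of_squares H"
  shows "0 \<le> \<phi> H"
proof -
  interpret unital_ring_hom \<phi> by (rule assms(1))
  obtain qs where "H = (\<Sum>q\<leftarrow>qs. q ^ 2)"
    using assms(2) by (auto simp: sum_of_squares_def)
  moreover have "0 \<le> \<phi> (\<Sum>q\<leftarrow>qs. q ^ 2)" for qs
    by (induction qs) (simp_all add: hom_zero hom_add hom_power)
  ultimately show ?thesis by simp
qed

section \<open>Total preorderings and real points\<close>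

text \<open>Properness, \<open>- 1 \<notin> P\<close>, stays a separate condition, so that adjoining
  an element always yields a preordering again.\<close>

definition preordering :: "'a::comm_ring_1 set \<Rightarrow> bool" where
  "preordering P \<longleftrightarrow> (\<forall>a. a * a \<in> P) \<and> (\<forall>a\<in>P. \<forall>b\<in>P. a + b \<in> P \<and> a * b \<in> P)"

text \<open>Terms linear in \<open>a\<close> suffice for closure under products, because
  \<open>a * a\<close> already lies in \<open>P\<close>.\<close>

lemma preordering_adjoin:
  assumes "preordering P"
  shows "preordering {p + a * q | p q. p \<in> P \<and> q \<in> P}" (is "preordering ?Q")
  unfolding preordering_def
proof (intro conjI allI ballI)
  have add: "x + y \<in> P" and mult: "x * y \<in> P" if "x \<in> P" "y \<in> P" for x y
    using assms that by (auto simp: preordering_def)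
  have sq: "x * x \<in> P" for x using assms by (simp add: preordering_def)
  have mem: "p + a * q \<in> ?Q" if "p \<in> P" "q \<in> P" for p q using that by blast
  show "c * c \<in> ?Q" for c using mem[OF sq[of c] sq[of 0]] by simp
  fix x y assume "x \<in> ?Q" "y \<in> ?Q"
  then obtain p q p' q' where eq: "x = p + a * q" "y = p' + a * q'"
    and P: "p \<in> P" "q \<in> P" "p' \<in> P" "q' \<in> P" by blast
  have "x + y = (p + p') + a * (q + q')" by (simp add: eq algebra_simps)
  then show "x + y \<in> ?Q" by (simp only: mem add P)
  have "x * y = (p * p' + (a * a) * (q * q')) + a * (p * q' + q * p')"
    by (simp add: eq algebra_simps)
  then show "x * y \<in> ?Q" by (simp only: mem add mult sq P)
qed

text \<open>Zorn's lemma gives a maximal proper preordering. If it missed both \<open>a\<close> and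
  \<open>- a\<close>, adjoining either one would produce \<open>- 1\<close>, and multiplying the two
  representations of \<open>- 1\<close> would put \<open>- 1\<close> into \<open>P\<close>
  itself.\<close>

lemma preordering_extend_total:
  assumes T: "preordering T" "- 1 \<notin> T"
  obtains P where "T \<subseteq> P" "preordering P" "- 1 \<notin> P" "\<And>a. a \<in> P \<or> - a \<in> P"
proof -
  define F where "F = {P. T \<subseteq> P \<and> preordering P \<and> - 1 \<notin> P}"
  have "\<exists>P\<in>F. \<forall>X\<in>F. P \<subseteq> X \<longrightarrow> X = P"
  proof (rule subset_Zorn_nonempty)
    show "F \<noteq> {}" using T by (auto simp: F_def)
  next
    fix C assume C: "C \<noteq> {}" "subset.chain F C"
    have sub: "C \<subseteq> F" using C(2) by (auto simp: subset.chain_def)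
    \<comment> \<open>Closure of the union under sums and products needs one member of the chain
      that contains both operands.\<close>
    have dir: "\<exists>X\<in>C. a \<in> X \<and> b \<in> X" if "a \<in> \<Union>C" "b \<in> \<Union>C" for a b
      proof -
      obtain X Y where "X \<in> C" "a \<in> X" "Y \<in> C" "b \<in> Y" using \<open>a \<in> \<Union>C\<close> \<open>b \<in> \<Union>C\<close> by blast
      moreover have "X \<subseteq> Y \<or> Y \<subseteq> X"
        using C(2) \<open>X \<in> C\<close> \<open>Y \<in> C\<close> by (auto simp: subset_chain_def)
      ultimately show ?thesis by blast
    qed
    have "preordering (\<Union>C)"
      unfolding preordering_def
    proof (intro conjI allI ballI)
      obtain X where "X \<in> C" "X \<in> F" using C(1) sub by blast
      then show "a * a \<in> \<Union>C" for a by (auto simp: F_def preordering_def)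
      show "a + b \<in> \<Union>C" "a * b \<in> \<Union>C" if ab: "a \<in> \<Union>C" "b \<in> \<Union>C" for a b
      proof -
        obtain X where "X \<in> C" "X \<in> F" "a \<in> X" "b \<in> X" using dir[OF ab] sub by blast
        moreover from this have "a + b \<in> X" "a * b \<in> X" by (auto simp: F_def preordering_def)
        ultimately show "a + b \<in> \<Union>C" "a * b \<in> \<Union>C" by blast+
      qed
    qed
    then show "\<Union>C \<in> F"
      using C(1) sub by (auto simp: F_def)
  qed
  then obtain P where P: "P \<in> F" and max: "\<And>X. X \<in> F \<Longrightarrow> P \<subseteq> X \<Longrightarrow> X = P"
    by blast
  have pre: "preordering P" and TP: "T \<subseteq> P" and neg: "- 1 \<notin> P"
    using P by (auto simp: F_def)
  have sq: "x * x \<in> P" for x using pre by (simp add: preordering_def)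
  have add: "x + y \<in> P" and mult: "x * y \<in> P" if "x \<in> P" "y \<in> P" for x y
    using pre that by (auto simp: preordering_def)
  have zero: "0 \<in> P" and one: "1 \<in> P" using sq[of 0] sq[of 1] by simp_all
  \<comment> \<open>By maximality, adjoining an element outside \<open>P\<close> must destroy
    properness.\<close>
  have ext: "\<exists>p\<in>P. \<exists>q\<in>P. - 1 = p + a * q" if "a \<notin> P" for a
  proof (rule ccontr)
    assume contra: "\<not> ?thesis"
    let ?Q = "{p + a * q | p q. p \<in> P \<and> q \<in> P}"
    have "p = p + a * 0" for p by simp
    with zero have "P \<subseteq> ?Q" by (intro subsetI CollectI exI conjI)
    moreover have "- 1 \<notin> ?Q" using contra by blast
    then have "?Q \<in> F"
      using preordering_adjoin[OF pre, of a] TP \<open>P \<subseteq> ?Q\<close> unfolding F_def by blast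
    ultimately have "?Q = P" using max by blast
    moreover have "0 + a * 1 \<in> ?Q" using zero one by blast
    ultimately show False using that by simp
  qed
  have total: "a \<in> P \<or> - a \<in> P" for a
  proof (rule ccontr)
    assume "\<not> ?thesis"
    then obtain p q s t where in_P: "p \<in> P" "q \<in> P" "s \<in> P" "t \<in> P"
      and pq: "- 1 = p + a * q" and st: "- 1 = s + (- a) * t"
      using ext[of a] ext[of "- a"] by auto
    \<comment> \<open>The product of \<open>a * q = - (1 + p)\<close> and
      \<open>a * t = 1 + s\<close> expresses \<open>- 1\<close> through \<open>p\<close>,
      \<open>s\<close>, \<open>q * t\<close> and the square \<open>a * a\<close>, all in
      \<open>P\<close>.\<close>
    have "a * q = - 1 - p" unfolding pq by simp
    moreover have "a * t = 1 + s"
      using arg_cong[OF st, of "\<lambda>x. - x + s"] by simp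
    moreover have "(p + s) + (p * s + (a * a) * (q * t)) = p + s + p * s + (a * q) * (a * t)"
      by (simp only: ac_simps)
    ultimately have "(p + s) + (p * s + (a * a) * (q * t)) = - 1"
      by (simp only:) (simp add: algebra_simps)
    moreover have "(p + s) + (p * s + (a * a) * (q * t)) \<in> P"
      by (simp only: add mult sq in_P)
    ultimately show False using neg by simp
  qed
  show thesis using that TP pre neg total by blast
qed

section \<open>Bounded elements and standard parts for a total preordering\<close>

locale total_preordering = unital_ring_hom h for h :: "real \<Rightarrow> 'a::comm_ring_1" +
  fixes P :: "'a set"
  assumes pre: "preordering P" and neg_one: "- 1 \<notin> P" and total: "a \<in> P \<or> - a \<in> P"
begin

lemma sq_in: "a * a \<in> P" and add_in: "a \<in> P \<Longrightarrow> b \<in> P \<Longrightarrow> a + b \<in> P"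
  and mult_in: "a \<in> P \<Longrightarrow> b \<in> P \<Longrightarrow> a * b \<in> P"
  using pre by (auto simp: preordering_def)

text \<open>Nonnegative reals are squares. For negative \<open>r\<close>, multiplying
  \<open>h r\<close> by the nonnegative constant \<open>h (- 1 / r)\<close> would give
  \<open>- 1\<close>.\<close>

lemma const_in_iff: "h r \<in> P \<longleftrightarrow> 0 \<le> r"
proof
  have nonneg: "h s \<in> P" if "0 \<le> s" for s
    using sq_in[of "h (sqrt s)"] that by (simp flip: hom_mult)
  show "h r \<in> P" if "0 \<le> r" using nonneg that .
  show "0 \<le> r" if "h r \<in> P"
  proof (rule ccontr)
    assume "\<not> 0 \<le> r"
    then have "h r * h (- 1 / r) \<in> P"
      using mult_in[OF that nonneg[of "- 1 / r"]] by (simp add: divide_nonneg_neg)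
    moreover have "h r * h (- 1 / r) = h (- 1)"
      using \<open>\<not> 0 \<le> r\<close> by (simp flip: hom_mult)
    ultimately show False using neg_one by (simp add: hom_uminus hom_one)
  qed
qed

text \<open>If instead \<open>- a\<close> lies in \<open>P\<close>, adding it to
  \<open>a + a\<close> still gives \<open>a\<close>.\<close>

lemma half_in: "a \<in> P" if "a + a \<in> P"
  using total[of a] add_in[OF that, of "- a"] by auto

text \<open>Write x <= y for \<open>y - x \<in> P\<close>. Either a <= 1, or 1 <= a and then a <=
  a^N <= r. This turns a bound on a power into a bound on the element.\<close>

lemma root_bound:
  assumes "h r - a ^ N \<in> P" "N > 0"
  shows "\<exists>s. h s - a \<in> P"
proof (cases "1 - a \<in> P")
  case True
  then show ?thesis by (metis hom_one)
next
  case False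
  then have ge: "a - 1 \<in> P" using total[of "1 - a"] by simp
  have a: "a \<in> P" using add_in[OF ge, of 1] sq_in[of 1] by simp
  have pow: "a ^ n - 1 \<in> P" for n
  proof (induction n)
    case 0
    then show ?case using sq_in[of 0] by simp
  next
    case (Suc n)
    have "a ^ Suc n - 1 = a * (a ^ n - 1) + (a - 1)" by (simp add: algebra_simps)
    then show ?case using add_in[OF mult_in[OF a Suc] ge] by (simp only:)
  qed
  have "a ^ N - a = a * (a ^ (N - 1) - 1)"
    using \<open>N > 0\<close> by (cases N) (simp_all add: algebra_simps)
  then have "a ^ N - a \<in> P" using mult_in[OF a pow] by simp
  from add_in[OF assms(1) this] have "h r - a \<in> P" by simp
  then show ?thesis ..
qed

definition finite_elements :: "'a set" where
  "finite_elements = {a. (\<exists>r. h r - a \<in> P) \<and> (\<exists>r. h r + a \<in> P)}"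

lemma finite_elementsE:
  assumes "a \<in> finite_elements"
  obtains r where "0 < r" "h r - a \<in> P" "h r + a \<in> P"
proof -
  obtain s t where st: "h s - a \<in> P" "h t + a \<in> P"
    using assms by (auto simp: finite_elements_def)
  define r where "r = \<bar>s\<bar> + \<bar>t\<bar> + 1"
  have "h (r - s) \<in> P" "h (r - t) \<in> P" by (simp_all add: const_in_iff r_def)
  then have "h (r - s) + (h s - a) \<in> P" "h (r - t) + (h t + a) \<in> P"
    using st by (simp_all only: add_in)
  then show thesis using that[of r] by (simp add: hom_diff r_def)
qed

lemma finite_elements_const: "h r \<in> finite_elements"
proof -
  have "h r - h r \<in> P" "h (- r) + h r \<in> P" using sq_in[of 0] by (simp_all add: hom_uminus)
  then show ?thesis unfolding finite_elements_def by blast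
qed

lemma finite_elements_add:
  assumes "a \<in> finite_elements" "b \<in> finite_elements"
  shows "a + b \<in> finite_elements"
proof -
  obtain r s where "h r - a \<in> P" "h r + a \<in> P" "h s - b \<in> P" "h s + b \<in> P"
    using assms by (metis finite_elementsE)
  then have "(h r - a) + (h s - b) \<in> P" "(h r + a) + (h s + b) \<in> P"
    by (simp_all only: add_in)
  then have "h (r + s) - (a + b) \<in> P" "h (r + s) + (a + b) \<in> P"
    by (simp_all add: hom_add algebra_simps)
  then show ?thesis by (auto simp: finite_elements_def)
qed

text \<open>Twice \<open>r * s - a * b\<close> equals
  \<open>(r - a) * (s + b) + (r + a) * (s - b)\<close>, constants being read through
  \<open>h\<close>, and similarly for the other sign; \<open>half_in\<close> removes the factor
  two.\<close>

lemma product_bound: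
  assumes "h r - a \<in> P" "h r + a \<in> P" "h s - b \<in> P" "h s + b \<in> P"
  shows "h (r * s) - a * b \<in> P" "h (r * s) + a * b \<in> P"
proof -
  have "(h r - a) * (h s + b) + (h r + a) * (h s - b) \<in> P"
    "(h r - a) * (h s - b) + (h r + a) * (h s + b) \<in> P"
    using assms by (simp_all only: add_in mult_in)
  then have "(h (r * s) - a * b) + (h (r * s) - a * b) \<in> P"
    "(h (r * s) + a * b) + (h (r * s) + a * b) \<in> P"
    by (simp_all add: hom_mult algebra_simps)
  then show "h (r * s) - a * b \<in> P" "h (r * s) + a * b \<in> P"
    using half_in by blast+
qed

lemma finite_elements_mult:
  assumes "a \<in> finite_elements" "b \<in> finite_elements"
  shows "a * b \<in> finite_elements"
proof -
  obtain r s where "h r - a \<in> P" "h r + a \<in> P" "h s - b \<in> P" "h s + b \<in> P"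
    using assms by (metis finite_elementsE)
  from product_bound[OF this] show ?thesis by (auto simp: finite_elements_def)
qed

definition infinitesimal :: "'a \<Rightarrow> bool" where
  "infinitesimal a \<longleftrightarrow> (\<forall>e>0. h e - a \<in> P \<and> h e + a \<in> P)"

lemma infinitesimal_add:
  assumes "infinitesimal a" "infinitesimal b"
  shows "infinitesimal (a + b)"
  unfolding infinitesimal_def
proof (intro allI impI)
  fix e :: real assume "0 < e"
  then have *: "h (e/2) - a \<in> P" "h (e/2) + a \<in> P" "h (e/2) - b \<in> P" "h (e/2) + b \<in> P"
    using assms by (auto simp: infinitesimal_def)
  have e: "h e = h (e/2) + h (e/2)" by (simp flip: hom_add)
  show "h e - (a + b) \<in> P \<and> h e + (a + b) \<in> P"
    unfolding e using add_in[OF *(1,3)] add_in[OF *(2,4)] by (simp add: algebra_simps)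
qed

lemma infinitesimal_mult:
  assumes "infinitesimal a" "b \<in> finite_elements"
  shows "infinitesimal (b * a)"
  unfolding infinitesimal_def
proof (intro allI impI)
  fix e :: real assume "0 < e"
  obtain r where r: "0 < r" "h r - b \<in> P" "h r + b \<in> P"
    using assms(2) by (rule finite_elementsE)
  \<comment> \<open>The bounds \<open>r\<close> for \<open>b\<close> and \<open>e / r\<close> for
    \<open>a\<close> multiply to \<open>e\<close>.\<close>
  have "h (e / r) - a \<in> P" "h (e / r) + a \<in> P"
    using assms(1) \<open>0 < e\<close> \<open>0 < r\<close> by (auto simp: infinitesimal_def)
  from product_bound[OF r(2,3) this] show "h e - b * a \<in> P \<and> h e + b * a \<in> P"
    using \<open>0 < r\<close> by simp
qed

text \<open>Testing against half of the absolute value of \<open>r\<close> suffices. This makes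
  standard parts unique.\<close>

lemma infinitesimal_const:
  assumes "infinitesimal (h r)"
  shows "r = 0"
proof (rule ccontr)
  assume "r \<noteq> 0"
  then have "h (\<bar>r\<bar> / 2 - r) \<in> P" "h (\<bar>r\<bar> / 2 + r) \<in> P"
    using assms by (auto simp: infinitesimal_def hom_diff hom_add)
  then show False using \<open>r \<noteq> 0\<close> by (auto simp: const_in_iff abs_if split: if_splits)
qed

text \<open>The standard part is the infimum of the set \<open>S\<close> of real upper bounds of
  \<open>a\<close>; the lower bound of \<open>a\<close> keeps \<open>S\<close> bounded
  below.\<close>

lemma standard_part_exists:
  assumes "a \<in> finite_elements"
  shows "\<exists>r. infinitesimal (a - h r)"
proof -
  define S where "S = {r. h r - a \<in> P}"
  obtain t where t: "h t - a \<in> P" "h t + a \<in> P"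
    using assms by (rule finite_elementsE)
  have "- t \<le> r" if "r \<in> S" for r
  proof -
    have "(h r - a) + (h t + a) \<in> P" using that t(2) by (simp only: add_in S_def mem_Collect_eq)
    then have "h (r + t) \<in> P" by (simp add: hom_add)
    then show ?thesis by (simp add: const_in_iff)
  qed
  then have bdd: "bdd_below S" by (rule bdd_belowI)
  have ne: "S \<noteq> {}" using t by (auto simp: S_def)
  have "h e - (a - h (Inf S)) \<in> P \<and> h e + (a - h (Inf S)) \<in> P" if "0 < e" for e
  proof
    obtain s where s: "s \<in> S" "s < Inf S + e"
      using cInf_lessD[OF ne, of "Inf S + e"] \<open>0 < e\<close> by auto
    have "h (Inf S + e - s) + (h s - a) \<in> P"
      using s by (intro add_in) (simp_all add: S_def const_in_iff)
    then show "h e - (a - h (Inf S)) \<in> P" by (simp add: hom_diff hom_add algebra_simps)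
    \<comment> \<open>Below the infimum there is no upper bound of \<open>a\<close>, so totality
      reverses the inequality.\<close>
    have "Inf S - e \<notin> S" using cInf_lower[OF _ bdd, of "Inf S - e"] \<open>0 < e\<close> by auto
    then have "- (h (Inf S - e) - a) \<in> P" using total unfolding S_def by blast
    then show "h e + (a - h (Inf S)) \<in> P" by (simp add: hom_diff algebra_simps)
  qed
  then show ?thesis by (auto simp: infinitesimal_def)
qed

text \<open>By uniqueness of standard parts it is enough that sums and products of standard parts
  are infinitesimally close to the sums and products of the elements.\<close>

lemma standard_part_hom:
  assumes fin: "\<And>a. a \<in> finite_elements"
  obtains \<phi> :: "'a \<Rightarrow> real" where "unital_ring_hom \<phi>" "\<And>r. \<phi> (h r) = r"
    "\<And>a. a \<in> P \<Longrightarrow> 0 \<le> \<phi> a"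
proof -
  obtain \<phi> where \<phi>: "\<And>a. infinitesimal (a - h (\<phi> a))"
    using standard_part_exists[OF fin] by metis
  have minus: "infinitesimal (- a)" if "infinitesimal a" for a
    using that by (auto simp: infinitesimal_def)
  have unique: "\<phi> a = r" if "infinitesimal (a - h r)" for a r
  proof -
    have "infinitesimal ((a - h (\<phi> a)) + - (a - h r))"
      by (intro infinitesimal_add minus \<phi> that)
    then have "infinitesimal (h (r - \<phi> a))" by (simp add: hom_diff)
    then show ?thesis using infinitesimal_const by force
  qed
  have const: "\<phi> (h r) = r" for r
    by (rule unique) (simp add: infinitesimal_def const_in_iff)
  have "unital_ring_hom \<phi>"
  proof
    show "\<phi> 1 = 1" using const[of 1] by (simp add: hom_one)
    fix a b
    have "infinitesimal ((a - h (\<phi> a)) + (b - h (\<phi> b)))"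
      by (intro infinitesimal_add \<phi>)
    then show "\<phi> (a + b) = \<phi> a + \<phi> b"
      by (intro unique) (simp add: hom_add algebra_simps)
    \<comment> \<open>This element is \<open>a * b - h (\<phi> a) * h (\<phi> b)\<close>, with each
      summand a bounded multiple of an infinitesimal.\<close>
    have "infinitesimal (a * (b - h (\<phi> b)) + h (\<phi> b) * (a - h (\<phi> a)))"
      by (intro infinitesimal_add infinitesimal_mult \<phi> fin)
    then show "\<phi> (a * b) = \<phi> a * \<phi> b"
      by (intro unique) (simp add: hom_mult algebra_simps)
  qed
  moreover have "0 \<le> \<phi> a" if "a \<in> P" for a
  proof (rule ccontr)
    assume neg: "\<not> 0 \<le> \<phi> a"
    \<comment> \<open>With this tolerance, adding \<open>a\<close> leaves the negative constant
      \<open>\<phi> a / 2\<close> in \<open>P\<close>.\<close>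
    then have "h (- \<phi> a / 2) - (a - h (\<phi> a)) \<in> P"
      using \<phi>[of a] by (auto simp: infinitesimal_def)
    from add_in[OF this that] have "h (- \<phi> a / 2 + \<phi> a) \<in> P" by (simp only: hom_add) simp
    then show False using neg by (simp add: const_in_iff)
  qed
  ultimately show thesis using that const by blast
qed

end

section \<open>Sums of squares modulo an ideal\<close>

lemma sum_of_squares_square: "sum_of_squares (a * a)"
  unfolding sum_of_squares_def by (rule exI[of _ "[a]"]) (simp add: power2_eq_square)

lemma sum_of_squares_add: "sum_of_squares a \<Longrightarrow> sum_of_squares b \<Longrightarrow> sum_of_squares (a + b)"
  unfolding sum_of_squares_def by (metis map_append sum_list_append)

lemma sum_of_squares_mult:
  assumes "sum_of_squares a" "sum_of_squares b"
  shows "sum_of_squares (a * b)"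
proof -
  have scale: "sum_of_squares (q ^ 2 * b)" for q
  proof -
    obtain ps where "b = (\<Sum>p\<leftarrow>ps. p ^ 2)" using assms(2) by (auto simp: sum_of_squares_def)
    then have "q ^ 2 * b = (\<Sum>p\<leftarrow>map ((*) q) ps. p ^ 2)"
      by (simp add: sum_list_const_mult power_mult_distrib o_def)
    then show ?thesis unfolding sum_of_squares_def by blast
  qed
  obtain qs where "a = (\<Sum>q\<leftarrow>qs. q ^ 2)" using assms(1) by (auto simp: sum_of_squares_def)
  moreover have "sum_of_squares ((\<Sum>q\<leftarrow>qs. q ^ 2) * b)" for qs
  proof (induction qs)
    case Nil
    then show ?case using sum_of_squares_square[of 0] by simp
  next
    case (Cons q qs)
    then show ?case by (simp add: distrib_right sum_of_squares_add scale)
  qed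
  ultimately show ?thesis by simp
qed

lemma ideal_gen_base: "a \<in> S \<Longrightarrow> a \<in> ideal_gen S"
  unfolding ideal_gen_def by (rule module.span_base[OF module_times])

lemma ideal_gen_0: "0 \<in> ideal_gen S"
  unfolding ideal_gen_def by (rule module.span_zero[OF module_times])

lemma ideal_gen_add: "a \<in> ideal_gen S \<Longrightarrow> b \<in> ideal_gen S \<Longrightarrow> a + b \<in> ideal_gen S"
  unfolding ideal_gen_def by (rule module.span_add[OF module_times])

lemma ideal_gen_diff: "a \<in> ideal_gen S \<Longrightarrow> b \<in> ideal_gen S \<Longrightarrow> a - b \<in> ideal_gen S"
  unfolding ideal_gen_def by (rule module.span_diff[OF module_times])

lemma ideal_gen_mult: "a \<in> ideal_gen S \<Longrightarrow> c * a \<in> ideal_gen S"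
  unfolding ideal_gen_def by (rule module.span_scale[OF module_times])

lemma (in unital_ring_hom) hom_ideal_gen_zero:
  assumes "a \<in> ideal_gen S" "\<And>s. s \<in> S \<Longrightarrow> \<phi> s = 0"
  shows "\<phi> a = 0"
  using assms(1) unfolding ideal_gen_def
  by (induction rule: module.span_induct_alt[OF module_times, consumes 1])
    (simp_all add: hom_zero hom_add hom_mult assms(2))

text \<open>In \<open>(g + s) * (g' + s')\<close> every term except \<open>s * s'\<close> lies in
  the ideal. A certificate exists exactly when this preordering contains \<open>- 1\<close>.\<close>

lemma preordering_ideal_sum_of_squares:
  "preordering {g + s | g s. g \<in> ideal_gen S \<and> sum_of_squares s}"
    (is "preordering ?T")
proof -
  have "a * a = 0 + a * a" for a :: 'a by simp
  then have "a * a \<in> ?T" for a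
    using ideal_gen_0[of S] sum_of_squares_square[of a] by blast
  moreover have "x + y \<in> ?T \<and> x * y \<in> ?T" if xy: "x \<in> ?T" "y \<in> ?T" for x y
  proof -
    obtain g s g' s' where eq: "x = g + s" "y = g' + s'"
      and g: "g \<in> ideal_gen S" "g' \<in> ideal_gen S" and s: "sum_of_squares s" "sum_of_squares s'"
      using xy by blast
    have "x + y = (g + g') + (s + s')" by (simp add: eq algebra_simps)
    then have "x + y \<in> ?T"
      using ideal_gen_add[OF g] sum_of_squares_add[OF s] by blast
    moreover have "x * y = ((g' + s') * g + s * g') + s * s'" by (simp add: eq algebra_simps)
    moreover have "(g' + s') * g + s * g' \<in> ideal_gen S"
      by (intro ideal_gen_add ideal_gen_mult g)
    ultimately show ?thesis
      using sum_of_squares_mult[OF s] by blast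
  qed
  ultimately show ?thesis unfolding preordering_def by simp
qed

section \<open>Polynomial substitution\<close>

text \<open>Reduces identities between additive maps to single terms.\<close>

lemma poly_mapping_additive_induct [case_names single add]:
  fixes p :: "'a \<Rightarrow>\<^sub>0 'b::comm_monoid_add"
  assumes single: "\<And>a c. Q (Poly_Mapping.single a c)"
    and add: "\<And>p q. Q p \<Longrightarrow> Q q \<Longrightarrow> Q (p + q)"
  shows "Q p"
proof (induction p rule: update_induct)
  case const
  then show ?case using single[of undefined 0] by simp
next
  case (update f a c)
  have "Poly_Mapping.update a c f = f + Poly_Mapping.single a c"
    using update(1) by (intro poly_mapping_eqI)
      (auto simp: lookup_update lookup_add lookup_single in_keys_iff)
  then show ?case using add[OF update(3) single] by simp
qed

lemma mconst_hom: "unital_ring_hom (mconst :: 'a::comm_ring_1 \<Rightarrow> ('x, 'a) mpoly)"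
  by unfold_locales (simp_all add: mconst_def single_add mult_single)

text \<open>Allows a common index set for exponents with different supports.\<close>

lemma expo_power_superset:
  assumes "finite K" "Poly_Mapping.keys \<alpha> \<subseteq> K"
  shows "expo_power g \<alpha> = (\<Prod>k\<in>K. g k ^ Poly_Mapping.lookup \<alpha> k)"
  unfolding expo_power_def
  by (rule prod.mono_neutral_left) (use assms in \<open>auto simp: in_keys_iff\<close>)

lemma expo_power_0 [simp]: "expo_power g 0 = 1"
  by (simp add: expo_power_def)

lemma expo_power_add: "expo_power g (\<alpha> + \<beta>) = expo_power g \<alpha> * expo_power g \<beta>"
proof -
  let ?K = "Poly_Mapping.keys \<alpha> \<union> Poly_Mapping.keys \<beta>"
  have "Poly_Mapping.keys (\<alpha> + \<beta>) \<subseteq> ?K" by (rule keys_add)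
  then show ?thesis
    by (simp add: expo_power_superset[of ?K] lookup_add power_add prod.distrib)
qed

lemma expo_power_single: "expo_power g (Poly_Mapping.single k n) = g k ^ n"
  by (simp add: expo_power_superset[of "{k}"])

lemma expo_power_pos:
  fixes g :: "'x \<Rightarrow> real"
  shows "(\<And>k. 0 < g k) \<Longrightarrow> 0 < expo_power g \<alpha>"
  by (simp add: expo_power_def prod_pos)

lemma expo_power_power:
  fixes g :: "'x \<Rightarrow> 'a::comm_semiring_1"
  shows "expo_power (\<lambda>k. g k ^ n) \<alpha> = expo_power g \<alpha> ^ n"
  unfolding expo_power_def prod_power_distrib
  by (intro prod.cong) (simp_all add: mult.commute flip: power_mult)

lemma mpoly_subst_single:
  "h 0 = 0 \<Longrightarrow> mpoly_subst h g (Poly_Mapping.single \<alpha> c) = h c * expo_power g \<alpha>"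
  by (simp add: mpoly_subst_def)

lemma mpoly_subst_superset:
  assumes "finite K" "Poly_Mapping.keys p \<subseteq> K" "h 0 = 0"
  shows "mpoly_subst h g p = (\<Sum>\<alpha>\<in>K. h (Poly_Mapping.lookup p \<alpha>) * expo_power g \<alpha>)"
  unfolding mpoly_subst_def
  by (rule sum.mono_neutral_left) (use assms in \<open>auto simp: in_keys_iff\<close>)

text \<open>Multiplicativity is biadditive in the two factors, so a nested induction reduces it to a
  product of two terms, where exponents add.\<close>

lemma mpoly_subst_hom:
  assumes "unital_ring_hom h"
  shows "unital_ring_hom (mpoly_subst h g)"
proof -
  interpret h: unital_ring_hom h by (rule assms)
  have single: "mpoly_subst h g (Poly_Mapping.single \<alpha> c) = h c * expo_power g \<alpha>" for \<alpha> c
    by (simp add: mpoly_subst_single h.hom_zero)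
  have add: "mpoly_subst h g (p + q) = mpoly_subst h g p + mpoly_subst h g q" for p q
  proof -
    let ?K = "Poly_Mapping.keys p \<union> Poly_Mapping.keys q"
    have "Poly_Mapping.keys (p + q) \<subseteq> ?K" by (rule keys_add)
    then show ?thesis
      by (simp add: mpoly_subst_superset[of ?K] h.hom_zero lookup_add h.hom_add distrib_right
          sum.distrib)
  qed
  show ?thesis
  proof
    show "mpoly_subst h g 1 = 1"
      using single[of 0 1] by (simp add: h.hom_one)
    show "mpoly_subst h g (p + q) = mpoly_subst h g p + mpoly_subst h g q" for p q
      by (rule add)
    show "mpoly_subst h g (p * q) = mpoly_subst h g p * mpoly_subst h g q" for p q
    proof (induction p rule: poly_mapping_additive_induct)
      case (single \<alpha> c)
      show ?case
      proof (induction q rule: poly_mapping_additive_induct)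
        case (single \<beta> d)
        show ?case
          by (simp add: mult_single \<open>\<And>\<alpha> c. mpoly_subst h g (Poly_Mapping.single \<alpha> c) = _\<close>
              h.hom_mult expo_power_add mult_ac)
      qed (simp add: distrib_left add)
    qed (simp add: distrib_right add)
  qed
qed

lemma mpoly_eval_hom: "unital_ring_hom (mpoly_eval g)"
  for g :: "'x \<Rightarrow> 'a::comm_ring_1"
  unfolding mpoly_eval_def by (rule mpoly_subst_hom) (simp add: unital_ring_hom_def)

lemma mpoly_eval_single: "mpoly_eval g (Poly_Mapping.single \<alpha> c) = c * expo_power g \<alpha>"
  unfolding mpoly_eval_def by (simp add: mpoly_subst_single)

lemma mpoly_eval_mvar: "mpoly_eval g (mvar k) = g k"
  by (simp add: mvar_def mpoly_eval_single expo_power_single)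

lemma mpoly_eval_mconst: "mpoly_eval g (mconst c) = c"
  by (simp add: mconst_def mpoly_eval_single)

lemma single_eq_mconst_expo_power:
  fixes \<alpha> :: "'x expo" and c :: "'a::comm_ring_1"
  shows "Poly_Mapping.single \<alpha> c = mconst c * expo_power mvar \<alpha>"
proof -
  have pow: "(mvar k :: ('x, 'a) mpoly) ^ n = Poly_Mapping.single (Poly_Mapping.single k n) 1" for k :: 'x and n
    by (induction n) (simp_all add: mvar_def mult_single flip: single_add)
  have "(\<Prod>k\<in>K. Poly_Mapping.single (e k) (1::'a)) = Poly_Mapping.single (\<Sum>k\<in>K. e k) 1"
    for K and e :: "'x \<Rightarrow> 'x \<Rightarrow>\<^sub>0 nat"
    by (induction K rule: infinite_finite_induct) (simp_all add: mult_single)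
  moreover have "(\<Sum>k\<in>Poly_Mapping.keys \<alpha>. Poly_Mapping.single k (Poly_Mapping.lookup \<alpha> k)) = \<alpha>"
    by (rule poly_mapping_eqI)
      (simp add: lookup_sum lookup_single when_def in_keys_iff)
  ultimately show ?thesis
    by (simp add: expo_power_def pow mconst_def mult_single)
qed

text \<open>Constants and variables generate the polynomial ring. This is what turns the standard
  part map into a real point.\<close>

lemma hom_eq_mpoly_eval:
  fixes \<phi> :: "('x, 'a::comm_ring_1) mpoly \<Rightarrow> 'a"
  assumes "unital_ring_hom \<phi>" "\<And>c. \<phi> (mconst c) = c"
  shows "\<phi> p = mpoly_eval (\<lambda>k. \<phi> (mvar k)) p"
proof -
  interpret \<phi>: unital_ring_hom \<phi> by (rule assms)
  interpret e: unital_ring_hom "mpoly_eval (\<lambda>k. \<phi> (mvar k))" by (rule mpoly_eval_hom)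
  show ?thesis
    by (induction p rule: poly_mapping_additive_induct)
      (simp_all add: \<phi>.hom_add e.hom_add mpoly_eval_single
        single_eq_mconst_expo_power \<phi>.hom_mult \<phi>.hom_expo_power e.hom_mult e.hom_expo_power
        mpoly_eval_mconst mpoly_eval_mvar assms(2))
qed

section \<open>Real and imaginary parts\<close>

lemma map_add_hom:
  assumes "h 0 = 0" "\<And>a b. h (a + b) = h a + h b"
  shows "Poly_Mapping.map h (p + q) = Poly_Mapping.map h p + Poly_Mapping.map h q"
  by (rule poly_mapping_eqI) (simp add: lookup_map_zero lookup_add assms)

lemma map_Re_add: "Poly_Mapping.map Re (p + q) = Poly_Mapping.map Re p + Poly_Mapping.map Re q"
  and map_Im_add: "Poly_Mapping.map Im (p + q) = Poly_Mapping.map Im p + Poly_Mapping.map Im q"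
  by (simp_all add: map_add_hom)

lemma map_Re_Im_mult:
  fixes p q :: "('x, complex) mpoly"
  shows "Poly_Mapping.map Re (p * q) =
      Poly_Mapping.map Re p * Poly_Mapping.map Re q - Poly_Mapping.map Im p * Poly_Mapping.map Im q \<and>
    Poly_Mapping.map Im (p * q) =
      Poly_Mapping.map Re p * Poly_Mapping.map Im q + Poly_Mapping.map Im p * Poly_Mapping.map Re q"
proof (induction p rule: poly_mapping_additive_induct)
  case (single \<alpha> c)
  show ?case
  proof (induction q rule: poly_mapping_additive_induct)
    case (single \<beta> d)
    show ?case by (simp add: mult_single flip: single_diff single_add)
  qed (simp add: distrib_left map_Re_add map_Im_add)
qed (simp add: distrib_right map_Re_add map_Im_add)

text \<open>This is the product of \<open>p\<close> with its coefficientwise complex conjugate,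
  hence multiplicative.\<close>

definition mpoly_norm :: "('x, complex) mpoly \<Rightarrow> ('x, real) mpoly" where
  "mpoly_norm p = (Poly_Mapping.map Re p)\<^sup>2 + (Poly_Mapping.map Im p)\<^sup>2"

lemma mpoly_norm_mult: "mpoly_norm (p * q) = mpoly_norm p * mpoly_norm q"
  by (simp add: mpoly_norm_def map_Re_Im_mult power2_eq_square algebra_simps)

lemma mpoly_norm_1: "mpoly_norm 1 = 1"
  by (simp add: mpoly_norm_def power2_eq_square mult_single flip: single_one)

lemma mpoly_norm_expo_power:
  fixes g :: "'k \<Rightarrow> ('x, complex) mpoly"
  shows "mpoly_norm (expo_power g \<alpha>) = expo_power (\<lambda>k. mpoly_norm (g k)) \<alpha>"
proof -
  have pow: "mpoly_norm (p ^ n) = mpoly_norm p ^ n" for p :: "('x, complex) mpoly" and n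
    by (induction n) (simp_all add: mpoly_norm_1 mpoly_norm_mult)
  have "mpoly_norm (\<Prod>k\<in>K. p k) = (\<Prod>k\<in>K. mpoly_norm (p k))" for K and p :: "'k \<Rightarrow> ('x, complex) mpoly"
    by (induction K rule: infinite_finite_induct) (simp_all add: mpoly_norm_1 mpoly_norm_mult)
  then show ?thesis by (simp add: expo_power_def pow)
qed

text \<open>Multiplicativity of \<open>mpoly_norm\<close> reduces the monomial to its variables, so
  the modulus generators of the ideal become monomials in the squared moduli minus
  constants.\<close>

lemma norm_single_re_im_part:
  "(re_part (Poly_Mapping.single \<alpha> 1))\<^sup>2 + (im_part (Poly_Mapping.single \<alpha> 1))\<^sup>2
    = expo_power (\<lambda>k. (mvar (Inl k))\<^sup>2 + (mvar (Inr k))\<^sup>2) \<alpha>"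
proof -
  have "mpoly_norm (mvar (Inl k) + mconst \<i> * mvar (Inr k)) = (mvar (Inl k))\<^sup>2 + (mvar (Inr k))\<^sup>2"
    for k :: 'a
    by (simp add: mpoly_norm_def mvar_def mconst_def mult_single map_Re_add map_Im_add)
  moreover have "XY_subst (Poly_Mapping.single \<alpha> 1)
      = expo_power (\<lambda>k. mvar (Inl k) + mconst \<i> * mvar (Inr k)) \<alpha>"
    unfolding XY_subst_def by (subst mpoly_subst_single) (simp_all add: mconst_def)
  ultimately show ?thesis
    by (simp add: re_part_def im_part_def mpoly_norm_expo_power flip: mpoly_norm_def)
qed

text \<open>Both sides are the value of \<open>XY_subst f\<close> at \<open>v\<close> regarded as a
  complex point \<open>w\<close>: the left by carrying out the substitution, the right by splitting
  the coefficients.\<close>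

lemma mpoly_eval_re_im_part:
  fixes v :: "'x + 'x \<Rightarrow> real"
  shows "mpoly_eval (\<lambda>k. Complex (v (Inl k)) (v (Inr k))) f
    = Complex (mpoly_eval v (re_part f)) (mpoly_eval v (im_part f))"
proof -
  define w where "w = (\<lambda>k. complex_of_real (v k))"
  interpret r: unital_ring_hom "mpoly_eval v" by (rule mpoly_eval_hom)
  interpret c: unital_ring_hom "mpoly_eval w" by (rule mpoly_eval_hom)
  interpret f: unital_ring_hom "mpoly_eval (\<lambda>k. Complex (v (Inl k)) (v (Inr k)))"
    by (rule mpoly_eval_hom)
  interpret s: unital_ring_hom XY_subst
    unfolding XY_subst_def by (intro mpoly_subst_hom mconst_hom)
  interpret of_real: unital_ring_hom complex_of_real by unfold_locales simp_all
  have "mpoly_eval w (XY_subst f) = mpoly_eval (\<lambda>k. Complex (v (Inl k)) (v (Inr k))) f"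
  proof (induction f rule: poly_mapping_additive_induct)
    case (single \<alpha> a)
    have "w (Inl k) + \<i> * w (Inr k) = Complex (v (Inl k)) (v (Inr k))" for k
      by (simp add: w_def complex_eq_iff)
    then show ?case
      unfolding XY_subst_def
      by (subst mpoly_subst_single)
        (simp_all add: mpoly_eval_single c.hom_mult c.hom_expo_power c.hom_add mpoly_eval_mvar
          mpoly_eval_mconst, simp add: mconst_def)
  qed (simp add: s.hom_add c.hom_add f.hom_add)
  moreover have "mpoly_eval w p
      = Complex (mpoly_eval v (Poly_Mapping.map Re p)) (mpoly_eval v (Poly_Mapping.map Im p))" for p
  proof (induction p rule: poly_mapping_additive_induct)
    case (single \<alpha> a)
    show ?case
      by (simp add: w_def mpoly_eval_single complex_eq_iff flip: of_real.hom_expo_power)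
  qed (simp add: map_Re_add map_Im_add r.hom_add c.hom_add complex_eq_iff)
  ultimately show ?thesis by (simp add: re_part_def im_part_def)
qed

section \<open>Exponent lattices\<close>

lemma det_Ints:
  fixes A :: "'a::comm_ring_1 ^ 'n ^ 'n"
  assumes "\<And>i j. A $ i $ j \<in> \<int>"
  shows "det A \<in> \<int>"
  unfolding det_def by (intro Ints_sum Ints_mult Ints_prod) (auto simp: assms)

text \<open>A basis chosen inside \<open>S\<close> gives an integer matrix \<open>A\<close>.
  Cramer's rule solves for the unit vector with denominator \<open>det A\<close>, and clearing it
  leaves integer coefficients.\<close>

lemma integer_span_multiple:
  fixes S :: "(real ^ 'n) set"
  assumes S: "span S = UNIV" and int: "\<And>x i. x \<in> S \<Longrightarrow> x $ i \<in> \<int>"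
  obtains B c N where "finite B" "B \<subseteq> S" "0 < (N::nat)"
    "(\<Sum>x\<in>B. real_of_int (c x) *\<^sub>R x) = real N *\<^sub>R axis k 1"
proof -
  obtain B where B: "B \<subseteq> S" "independent B" "S \<subseteq> span B"
    using maximal_independent_subset[of S] by blast
  have spanB: "span B = UNIV" using S B(3) by (metis span_mono span_span top.extremum_unique)
  have "card B = CARD('n)" "finite B"
    using independent_bound[OF B(2)] B(2) spanB basis_card_eq_dim[of B UNIV] by auto
  then obtain e :: "'n \<Rightarrow> real ^ 'n" where e: "bij_betw e UNIV B"
    by (metis finite_same_card_bij finite_class.finite_UNIV)
  define A where "A = (\<chi> i j. e j $ i)"
  have col: "column j A = e j" for j by (simp add: A_def column_def vec_eq_iff)
  have "columns A = B" using e by (auto simp: columns_def col bij_betw_def)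
  then have "invertible A"
    using spanB by (simp add: invertible_right_inverse matrix_right_invertible_span_columns span_vec_eq)
  then have det: "det A \<noteq> 0" by (simp add: invertible_det_nz)
  have eS: "e j \<in> S" for j using e B(1) by (auto simp: bij_betw_def)
  have "A $ i $ j \<in> \<int>" for i j by (simp add: A_def int eS)
  then have detA: "det A \<in> \<int>" by (rule det_Ints)
  \<comment> \<open>The numerators in Cramer's rule: column \<open>l\<close> is replaced by the unit
    vector.\<close>
  define D where "D = (\<lambda>l. det (\<chi> i j. if j = l then axis k 1 $ i else A $ i $ j))"
  have "D l \<in> \<int>" for l
    unfolding D_def by (rule det_Ints) (auto simp: A_def int eS axis_def)
  define x where "x = (\<chi> l. D l / det A)"
  have "A *v x = axis k 1"
    using cramer[OF det, of x "axis k 1"] by (simp add: x_def D_def)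
  then have "(\<Sum>l\<in>UNIV. (D l / det A) *\<^sub>R e l) = axis k 1"
    by (simp add: matrix_mult_sum col x_def scalar_mult_eq_scaleR)
  then have "det A *\<^sub>R (\<Sum>l\<in>UNIV. (D l / det A) *\<^sub>R e l) = det A *\<^sub>R axis k 1" by simp
  then have eq: "(\<Sum>l\<in>UNIV. D l *\<^sub>R e l) = det A *\<^sub>R axis k 1"
    using det by (simp add: scaleR_sum_right)
  \<comment> \<open>The sign is moved into the coefficients so that the multiple becomes a positive
    natural number.\<close>
  have "(\<Sum>l\<in>UNIV. (sgn (det A) * D l) *\<^sub>R e l) = \<bar>det A\<bar> *\<^sub>R axis k 1"
    using arg_cong[OF eq, of "\<lambda>y. sgn (det A) *\<^sub>R y"]
    by (simp add: scaleR_sum_right abs_sgn mult.commute)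
  moreover obtain N where N: "\<bar>det A\<bar> = real N"
    using detA by (metis Ints_cases of_int_abs abs_ge_zero nonneg_int_cases of_int_of_nat_eq)
  moreover have "sgn (det A) \<in> \<int>" by (simp add: sgn_real_def)
  then have "\<exists>c. sgn (det A) * D l = real_of_int c" for l
    using \<open>D l \<in> \<int>\<close> by (metis Ints_cases Ints_mult)
  then obtain c where "\<And>l. sgn (det A) * D l = real_of_int (c l)" by metis
  ultimately have "(\<Sum>l\<in>UNIV. real_of_int (c l) *\<^sub>R e l) = real N *\<^sub>R axis k 1" by simp
  also have "(\<Sum>l\<in>UNIV. real_of_int (c l) *\<^sub>R e l)
      = (\<Sum>x\<in>B. real_of_int (c (inv e x)) *\<^sub>R x)"
    using sum.reindex_bij_betw[OF e, of "\<lambda>x. real_of_int (c (inv e x)) *\<^sub>R x"] e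
    by (simp add: bij_betw_def)
  finally show thesis
    using that[of B N "c \<circ> inv e"] \<open>finite B\<close> B(1) N det by simp
qed

text \<open>Exponents cannot be negative, so the integer combination is written as a difference of
  two natural combinations, both in \<open>G\<close>; the subtracted one is removed by
  \<open>cancel\<close>.\<close>

lemma exponent_multiple_in_saturated_monoid:
  fixes E G :: "('n::finite \<Rightarrow>\<^sub>0 nat) set"
  assumes span: "span ((\<lambda>\<alpha>. \<chi> k. real (Poly_Mapping.lookup \<alpha> k)) ` E) = (UNIV :: (real ^ 'n) set)"
    and EG: "E \<subseteq> G" and zero: "0 \<in> G"
    and add: "\<And>\<alpha> \<beta>. \<alpha> \<in> G \<Longrightarrow> \<beta> \<in> G \<Longrightarrow> \<alpha> + \<beta> \<in> G"
    and cancel: "\<And>\<alpha> \<beta>. \<alpha> + \<beta> \<in> G \<Longrightarrow> \<beta> \<in> G \<Longrightarrow> \<alpha> \<in> G"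
  shows "\<exists>N>0. Poly_Mapping.single k N \<in> G"
proof -
  define vec where "vec = (\<lambda>\<alpha> :: 'n \<Rightarrow>\<^sub>0 nat. (\<chi> k. real (Poly_Mapping.lookup \<alpha> k)) :: real ^ 'n)"
  have vec_add: "vec (\<alpha> + \<beta>) = vec \<alpha> + vec \<beta>" for \<alpha> \<beta>
    by (simp add: vec_def vec_eq_iff lookup_add)
  have vec_0: "vec 0 = 0" by (simp add: vec_def vec_eq_iff)
  have vec_inj: "\<alpha> = \<beta>" if "vec \<alpha> = vec \<beta>" for \<alpha> \<beta>
    using that by (intro poly_mapping_eqI) (simp add: vec_def vec_eq_iff)
  have comb: "\<exists>\<beta>\<in>G. vec \<beta> = (\<Sum>x\<in>B. real (n x) *\<^sub>R x)" if "finite B" "B \<subseteq> vec ` E" for B and n :: "_ \<Rightarrow> nat"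
    using that
  proof (induction B rule: finite_induct)
    case empty
    then show ?case using zero vec_0 by auto
  next
    case (insert x B)
    then obtain \<beta> \<alpha> where \<beta>: "\<beta> \<in> G" "vec \<beta> = (\<Sum>x\<in>B. real (n x) *\<^sub>R x)"
      and \<alpha>: "\<alpha> \<in> G" "x = vec \<alpha>" using EG by auto
    have "\<exists>\<gamma>\<in>G. vec \<gamma> = real i *\<^sub>R x" for i
    proof (induction i)
      case 0
      then show ?case using zero vec_0 by auto
    next
      case (Suc i)
      then obtain \<gamma> where "\<gamma> \<in> G" "vec \<gamma> = real i *\<^sub>R x" by auto
      then have "\<alpha> + \<gamma> \<in> G" "vec (\<alpha> + \<gamma>) = real (Suc i) *\<^sub>R x"
        using add \<alpha> by (simp_all add: vec_add scaleR_add_left)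
      then show ?case by blast
    qed
    then obtain \<gamma> where "\<gamma> \<in> G" "vec \<gamma> = real (n x) *\<^sub>R x" by blast
    then have "\<gamma> + \<beta> \<in> G" "vec (\<gamma> + \<beta>) = (\<Sum>x\<in>insert x B. real (n x) *\<^sub>R x)"
      using add \<beta> insert by (simp_all add: vec_add)
    then show ?case by blast
  qed
  have nat_diff: "real (nat i) - real (nat (- i)) = real_of_int i" for i
    by (cases "0 \<le> i") auto
  have "span (vec ` E) = UNIV" using span by (simp add: vec_def)
  then obtain B c N where B: "finite B" "B \<subseteq> vec ` E" and "0 < (N::nat)"
    and eq: "(\<Sum>x\<in>B. real_of_int (c x) *\<^sub>R x) = real N *\<^sub>R axis k 1"
    by (rule integer_span_multiple[of "vec ` E" k]) (auto simp: vec_def)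
  \<comment> \<open>\<open>\<beta>\<close> collects the positive and \<open>\<gamma>\<close> the
    negative parts of the coefficients.\<close>
  obtain \<beta> \<gamma> where \<beta>: "\<beta> \<in> G" "vec \<beta> = (\<Sum>x\<in>B. real (nat (c x)) *\<^sub>R x)"
    and \<gamma>: "\<gamma> \<in> G" "vec \<gamma> = (\<Sum>x\<in>B. real (nat (- c x)) *\<^sub>R x)"
    using comb[OF B, of "\<lambda>x. nat (c x)"] comb[OF B, of "\<lambda>x. nat (- c x)"] by blast
  have "vec \<beta> - vec \<gamma> = (\<Sum>x\<in>B. real_of_int (c x) *\<^sub>R x)"
    unfolding \<beta> \<gamma> sum_subtractf[symmetric]
    by (intro sum.cong refl) (simp add: nat_diff flip: scaleR_diff_left)
  also have "\<dots> = vec (Poly_Mapping.single k N)"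
    unfolding eq by (simp add: vec_def vec_eq_iff axis_def lookup_single when_def)
  finally have "vec (Poly_Mapping.single k N + \<gamma>) = vec \<beta>" by (simp add: vec_add algebra_simps)
  then have "Poly_Mapping.single k N + \<gamma> \<in> G" using vec_inj \<beta>(1) by metis
  then show ?thesis using cancel \<gamma>(1) \<open>0 < N\<close> by blast
qed

section \<open>The certificate\<close>

text \<open>\<open>G\<close> consists of the exponents at which \<open>u\<close> and
  \<open>w\<close> have equal powers modulo the ideal. Such congruences multiply, and they can be
  cancelled because \<open>expo_power w \<beta>\<close> is a positive, hence invertible,
  constant.\<close>

lemma modulus_exponents_saturated:
  fixes u :: "'x \<Rightarrow> 'a::comm_ring_1" and w :: "'x \<Rightarrow> real" and S :: "'a set"
  assumes "unital_ring_hom h" "\<And>k. 0 < w k"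
  defines "G \<equiv> {\<beta>. expo_power u \<beta> - h (expo_power w \<beta>) \<in> ideal_gen S}"
  shows "0 \<in> G" "\<alpha> \<in> G \<Longrightarrow> \<beta> \<in> G \<Longrightarrow> \<alpha> + \<beta> \<in> G" "\<alpha> + \<beta> \<in> G \<Longrightarrow> \<beta> \<in> G \<Longrightarrow> \<alpha> \<in> G"
proof -
  interpret h: unital_ring_hom h by (rule assms)
  define U W where "U = expo_power u" and "W = (\<lambda>\<beta>. h (expo_power w \<beta>))"
  have G: "\<beta> \<in> G \<longleftrightarrow> U \<beta> - W \<beta> \<in> ideal_gen S" for \<beta>
    by (simp add: G_def U_def W_def)
  have UW: "U (\<alpha> + \<beta>) = U \<alpha> * U \<beta>" "W (\<alpha> + \<beta>) = W \<alpha> * W \<beta>" for \<alpha> \<beta>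
    by (simp_all add: U_def W_def expo_power_add h.hom_mult)
  show "0 \<in> G" by (simp add: G_def h.hom_one ideal_gen_0)
  show "\<alpha> + \<beta> \<in> G" if "\<alpha> \<in> G" "\<beta> \<in> G"
  proof -
    have "U \<beta> * (U \<alpha> - W \<alpha>) + W \<alpha> * (U \<beta> - W \<beta>) \<in> ideal_gen S"
      using that by (intro ideal_gen_add ideal_gen_mult) (simp_all add: G)
    then show ?thesis by (simp add: G UW algebra_simps)
  qed
  show "\<alpha> \<in> G" if "\<alpha> + \<beta> \<in> G" "\<beta> \<in> G"
  proof -
    define c where "c = h (1 / expo_power w \<beta>)"
    have "c * W \<beta> = h (1 / expo_power w \<beta> * expo_power w \<beta>)"
      by (simp only: c_def W_def h.hom_mult)
    also have "\<dots> = 1"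
      using expo_power_pos[of w \<beta>] assms(2) by (simp add: h.hom_one less_imp_neq[symmetric])
    finally have c: "c * W \<beta> = 1" .
    have "U (\<alpha> + \<beta>) - W (\<alpha> + \<beta>) \<in> ideal_gen S" "U \<beta> - W \<beta> \<in> ideal_gen S"
      using that by (simp_all add: G)
    \<comment> \<open>Replacing \<open>U \<beta>\<close> by \<open>W \<beta>\<close> leaves
      \<open>W \<beta> * (U \<alpha> - W \<alpha>)\<close>, and \<open>c\<close> is the inverse of
      \<open>W \<beta>\<close>.\<close>
    then have "c * ((U (\<alpha> + \<beta>) - W (\<alpha> + \<beta>)) - U \<alpha> * (U \<beta> - W \<beta>)) \<in> ideal_gen S"
      by (simp only: ideal_gen_diff ideal_gen_mult)
    also have "c * ((U (\<alpha> + \<beta>) - W (\<alpha> + \<beta>)) - U \<alpha> * (U \<beta> - W \<beta>))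
        = (c * W \<beta>) * (U \<alpha> - W \<alpha>)"
      by (simp add: UW algebra_simps)
    finally show ?thesis by (simp add: G c)
  qed
qed

text \<open>\<open>root_bound\<close> passes from the power to the sum of two squares; dropping one
  square and applying it again bounds each variable. Bounded elements are closed under ring
  operations, so every polynomial is bounded.\<close>

lemma finite_elements_eq_UNIV:
  fixes P :: "('n + 'n, real) mpoly set"
  assumes "total_preordering mconst P"
    and bound: "\<And>k. \<exists>r N. 0 < N \<and> mconst r - ((mvar (Inl k))\<^sup>2 + (mvar (Inr k))\<^sup>2) ^ N \<in> P"
  shows "p \<in> total_preordering.finite_elements mconst P"
proof -
  interpret total_preordering mconst P by (rule assms(1))
  have square: "a \<in> finite_elements" if "mconst r - a\<^sup>2 \<in> P" for a r
  proof -
    \<comment> \<open>Since \<open>a\<close> and \<open>- a\<close> have the same square,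
      \<open>root_bound\<close> gives bounds on both sides.\<close>
    have "\<exists>s. mconst s - a \<in> P" "\<exists>s. mconst s - (- a) \<in> P"
      using that by (intro root_bound[of r _ 2]; simp)+
    then show ?thesis by (simp add: finite_elements_def)
  qed
  have "mvar l \<in> finite_elements" for l
  proof -
    obtain k where k: "l = Inl k \<or> l = Inr k" by (cases l) auto
    define x y where "x = (mvar (Inl k) :: ('n + 'n, real) mpoly)"
      and "y = (mvar (Inr k) :: ('n + 'n, real) mpoly)"
    obtain s where s: "mconst s - (x\<^sup>2 + y\<^sup>2) \<in> P"
      using bound[of k] root_bound unfolding x_def y_def by blast
    have "mconst s - x\<^sup>2 \<in> P" "mconst s - y\<^sup>2 \<in> P"
      using add_in[OF s sq_in[of y]] add_in[OF s sq_in[of x]] by (simp_all add: power2_eq_square)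
    then show ?thesis using k square unfolding x_def y_def by blast
  qed
  moreover have "a ^ i \<in> finite_elements" if "a \<in> finite_elements" for a i
    by (induction i) (use that finite_elements_mult finite_elements_const[of 1] in
      \<open>simp_all add: hom_one\<close>)
  moreover have "(\<Prod>k\<in>K. g k) \<in> finite_elements" if "\<And>k. g k \<in> finite_elements"
    for K and g :: "'n + 'n \<Rightarrow> ('n + 'n, real) mpoly"
    by (induction K rule: infinite_finite_induct) (use that finite_elements_mult
      finite_elements_const[of 1] in \<open>simp_all add: hom_one\<close>)
  ultimately have "expo_power mvar \<alpha> \<in> finite_elements" for \<alpha>
    by (simp add: expo_power_def)
  then show ?thesis
    by (induction p rule: poly_mapping_additive_induct)
      (simp_all add: single_eq_mconst_expo_power finite_elements_mult finite_elements_const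
        finite_elements_add)
qed

lemma real_point_of_no_certificate:
  fixes S :: "('n + 'n, real) mpoly set"
  assumes no_cert: "\<And>G H. G \<in> ideal_gen S \<Longrightarrow> sum_of_squares H \<Longrightarrow> G + H + 1 \<noteq> 0"
    and bound: "\<And>k. \<exists>r N. 0 < N \<and>
      ((mvar (Inl k))\<^sup>2 + (mvar (Inr k))\<^sup>2) ^ N - mconst r \<in> ideal_gen S"
  shows "\<exists>v. \<forall>p\<in>ideal_gen S. mpoly_eval v p = 0"
proof -
  let ?T = "{g + s | g s. g \<in> ideal_gen S \<and> sum_of_squares s}"
  have "- 1 \<notin> ?T"
  proof
    assume "- 1 \<in> ?T"
    then obtain g s where "g \<in> ideal_gen S" "sum_of_squares s" "- 1 = g + s" by blast
    moreover from this(3) have "g + s + 1 = 0" by (simp flip: \<open>- 1 = g + s\<close>)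
    ultimately show False using no_cert by blast
  qed
  with preordering_ideal_sum_of_squares obtain P
    where P: "?T \<subseteq> P" "preordering P" "- 1 \<notin> P" "\<And>a. a \<in> P \<or> - a \<in> P"
    by (rule preordering_extend_total) (rule that)
  interpret h: unital_ring_hom "mconst :: real \<Rightarrow> ('n + 'n, real) mpoly" by (rule mconst_hom)
  interpret total_preordering "mconst :: real \<Rightarrow> ('n + 'n, real) mpoly" P
    by unfold_locales (use P in auto)
  have ideal: "a \<in> P" if "a \<in> ideal_gen S" for a
  proof -
    have "a + 0 * 0 \<in> ?T" using that sum_of_squares_square[of 0] by blast
    then show ?thesis using P(1) by auto
  qed
  have neg: "- a \<in> ideal_gen S" if "a \<in> ideal_gen S" for a
    using ideal_gen_diff[OF ideal_gen_0 that] by simp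
  have "\<exists>r N. 0 < N \<and> mconst r - ((mvar (Inl k))\<^sup>2 + (mvar (Inr k))\<^sup>2) ^ N \<in> P" for k
  proof -
    obtain r N where "0 < N" "((mvar (Inl k))\<^sup>2 + (mvar (Inr k))\<^sup>2) ^ N - mconst r \<in> ideal_gen S"
      using bound by blast
    with ideal[OF neg[OF this(2)]] show ?thesis by (auto intro!: exI)
  qed
  then have "a \<in> finite_elements" for a
    by (rule finite_elements_eq_UNIV[OF total_preordering_axioms])
  then obtain \<phi> :: "('n + 'n, real) mpoly \<Rightarrow> real" where \<phi>: "unital_ring_hom \<phi>"
    "\<And>r. \<phi> (mconst r) = r" "\<And>a. a \<in> P \<Longrightarrow> 0 \<le> \<phi> a"
    by (rule standard_part_hom) (rule that)
  \<comment> \<open>The ideal lies in \<open>P\<close> together with its negatives, so the values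
    are both nonnegative and nonpositive.\<close>
  have "\<phi> a = 0" if "a \<in> ideal_gen S" for a
    using \<phi>(3)[of a] \<phi>(3)[of "- a"] ideal neg that
    by (simp add: unital_ring_hom.hom_uminus[OF \<phi>(1)])
  then show ?thesis
    by (intro exI[of _ "\<lambda>k. \<phi> (mvar k)"]) (simp flip: hom_eq_mpoly_eval[OF \<phi>(1,2)])
qed

text \<open>The alternative is taken in its exclusive sense: exactly one of the two cases
  occurs.\<close>

theorem corollary3p7:
  fixes r :: nat
    and d :: "nat \<Rightarrow> nat"
    and b :: "nat \<Rightarrow> nat \<Rightarrow> complex"
    and \<alpha> :: "nat \<Rightarrow> nat \<Rightarrow> ('n::finite) expo"
    and f :: "nat \<Rightarrow> ('n, complex) mpoly"
    and I :: "('n, complex) mpoly set"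
    and lam :: "real ^ 'n"
    and m :: "nat \<Rightarrow> nat \<Rightarrow> ('n, complex) mpoly"
    and \<mu> :: "nat \<Rightarrow> nat \<Rightarrow> real"
    and Istar :: "('n + 'n, real) mpoly set"
  assumes f: "\<And>i. i \<in> {1..r} \<Longrightarrow> f i = (\<Sum>j=1..d i. Poly_Mapping.single (\<alpha> i j) (b i j))"
    and b: "\<And>i j. i \<in> {1..r} \<Longrightarrow> j \<in> {1..d i} \<Longrightarrow> b i j \<noteq> 0"
    and I: "I = ideal_gen (f ` {1..r})"
    and spans: "span (\<Union>i\<in>{1..r}. \<Union>j\<in>{1..d i}.
                  {\<chi> k. real (Poly_Mapping.lookup (\<alpha> i j) k)}) = (UNIV :: (real ^ 'n) set)"
    and lam: "\<And>k. lam $ k > 0"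
    and m: "\<And>i j. i \<in> {1..r} \<Longrightarrow> j \<in> {1..d i} \<Longrightarrow> m i j = Poly_Mapping.single (\<alpha> i j) 1"
    and \<mu>: "\<And>i j. i \<in> {1..r} \<Longrightarrow> j \<in> {1..d i} \<Longrightarrow> \<mu> i j = expo_power (\<lambda>k. lam $ k) (\<alpha> i j)"
    and Istar: "Istar = ideal_gen
          ((\<Union>i\<in>{1..r}. {re_part (f i), im_part (f i)}) \<union>
           (\<Union>i\<in>{1..r}. \<Union>j\<in>{1..d i}.
              {(re_part (m i j))\<^sup>2 + (im_part (m i j))\<^sup>2 - mconst ((\<mu> i j)\<^sup>2)}))"
  defines "certificate \<equiv> (\<exists>G H. G \<in> Istar \<and> sum_of_squares H \<and> G + H + 1 = 0)"
  shows "(lam \<in> unlog_amoeba I \<or> certificate) \<and> \<not> (lam \<in> unlog_amoeba I \<and> certificate)"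
proof -
  define S where "S = (\<Union>i\<in>{1..r}. {re_part (f i), im_part (f i)}) \<union>
    (\<Union>i\<in>{1..r}. \<Union>j\<in>{1..d i}.
      {(re_part (m i j))\<^sup>2 + (im_part (m i j))\<^sup>2 - mconst ((\<mu> i j)\<^sup>2)})"
  have Istar_eq: "Istar = ideal_gen S" by (simp add: Istar S_def)
  \<comment> \<open>Squared moduli of the variables and their prescribed values; with them the
    modulus generators take the form treated in \<open>modulus_exponents_saturated\<close>.\<close>
  define u where "u = (\<lambda>k. (mvar (Inl k))\<^sup>2 + (mvar (Inr k))\<^sup>2 :: ('n + 'n, real) mpoly)"
  define w where "w = (\<lambda>k. (lam $ k)\<^sup>2)"
  have norm_gen: "(re_part (m i j))\<^sup>2 + (im_part (m i j))\<^sup>2 - mconst ((\<mu> i j)\<^sup>2)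
      = expo_power u (\<alpha> i j) - mconst (expo_power w (\<alpha> i j))"
    if "i \<in> {1..r}" "j \<in> {1..d i}" for i j
    using that by (simp add: m \<mu> norm_single_re_im_part u_def w_def expo_power_power)
  have eval_u: "mpoly_eval v (u k) = (cmod (Complex (v (Inl k)) (v (Inr k))))\<^sup>2" for v k
  proof -
    interpret unital_ring_hom "mpoly_eval v" by (rule mpoly_eval_hom)
    show ?thesis by (simp add: u_def hom_add hom_power mpoly_eval_mvar cmod_power2)
  qed
  have "\<not> certificate" if "lam \<in> unlog_amoeba I"
  proof
    assume certificate
    then obtain G H where GH: "G \<in> ideal_gen S" "sum_of_squares H" "G + H + 1 = 0"
      by (auto simp: certificate_def Istar_eq)
    obtain z where z: "z \<in> variety I" and lam_z: "lam = (\<chi> k. cmod (z $ k))"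
      using \<open>lam \<in> unlog_amoeba I\<close> by (auto simp: unlog_amoeba_def)
    define v where "v = case_sum (\<lambda>k. Re (z $ k)) (\<lambda>k. Im (z $ k))"
    interpret e: unital_ring_hom "mpoly_eval v" by (rule mpoly_eval_hom)
    have v: "Complex (v (Inl k)) (v (Inr k)) = z $ k" for k by (simp add: v_def)
    have "mpoly_eval v s = 0" if "s \<in> S" for s
    proof -
      have "mpoly_eval v (re_part (f i)) = 0 \<and> mpoly_eval v (im_part (f i)) = 0"
        if "i \<in> {1..r}" for i
      proof -
        have "f i \<in> I" using that by (auto simp: I intro: ideal_gen_base)
        then have "mpoly_eval (\<lambda>k. z $ k) (f i) = 0" using z by (simp add: variety_def)
        then show ?thesis using mpoly_eval_re_im_part[of v "f i"] by (simp add: v complex_eq_iff)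
      qed
      \<comment> \<open>At this point \<open>u k\<close> evaluates to the squared modulus of
        \<open>z $ k\<close>, which is \<open>w k\<close>, so the relation holds for every
        exponent.\<close>
      moreover have "mpoly_eval v (expo_power u \<beta> - mconst (expo_power w \<beta>)) = 0" for \<beta>
        by (simp add: e.hom_diff e.hom_expo_power eval_u v mpoly_eval_mconst w_def lam_z)
      ultimately show ?thesis using \<open>s \<in> S\<close> by (auto simp: S_def norm_gen)
    qed
    then have "mpoly_eval v G = 0" by (rule e.hom_ideal_gen_zero[OF GH(1)])
    moreover have "0 \<le> mpoly_eval v H"
      by (rule hom_sum_of_squares_nonneg[OF mpoly_eval_hom GH(2)])
    moreover have "mpoly_eval v G + mpoly_eval v H + 1 = 0"
      using arg_cong[OF GH(3), of "mpoly_eval v"] by (simp add: e.hom_add e.hom_one e.hom_zero)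
    ultimately show False by simp
  qed
  moreover have "lam \<in> unlog_amoeba I" if "\<not> certificate"
  proof -
    define E where "E = (\<Union>i\<in>{1..r}. \<Union>j\<in>{1..d i}. {\<alpha> i j})"
    define L where "L = {\<beta>. expo_power u \<beta> - mconst (expo_power w \<beta>) \<in> ideal_gen S}"
    have w_pos: "0 < w k" for k using lam[of k] by (simp add: w_def)
    note saturated = modulus_exponents_saturated[where h = mconst and w = w and u = u and S = S, OF mconst_hom w_pos,
        folded L_def]
    have "(\<lambda>\<alpha>. \<chi> k. real (Poly_Mapping.lookup \<alpha> k) :: real ^ 'n) ` E
        = (\<Union>i\<in>{1..r}. \<Union>j\<in>{1..d i}. {\<chi> k. real (Poly_Mapping.lookup (\<alpha> i j) k)})"
      by (simp add: E_def image_UN)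
    then have spanE: "span ((\<lambda>\<alpha>. \<chi> k. real (Poly_Mapping.lookup \<alpha> k)) ` E)
        = (UNIV :: (real ^ 'n) set)"
      using spans by simp
    have "expo_power u (\<alpha> i j) - mconst (expo_power w (\<alpha> i j)) \<in> S"
      if "i \<in> {1..r}" "j \<in> {1..d i}" for i j
      unfolding S_def norm_gen[OF that, symmetric] using that by blast
    then have "E \<subseteq> L" by (auto simp: E_def L_def intro: ideal_gen_base)
    \<comment> \<open>Here the spanning hypothesis enters: it isolates the single variables and so
      provides the bounds needed for the real point.\<close>
    then have "\<exists>N>0. Poly_Mapping.single k N \<in> L" for k
      by (rule exponent_multiple_in_saturated_monoid[OF spanE]) (fact saturated)+
    then have "\<exists>N>0. u k ^ N - mconst (w k ^ N) \<in> ideal_gen S" for k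
      by (simp add: L_def expo_power_single)
    then obtain N where N: "\<And>k. 0 < N k" "\<And>k. u k ^ N k - mconst (w k ^ N k) \<in> ideal_gen S"
      by metis
    have "\<exists>v. \<forall>p\<in>ideal_gen S. mpoly_eval v p = 0"
    proof (rule real_point_of_no_certificate)
      show "G + H + 1 \<noteq> 0" if "G \<in> ideal_gen S" "sum_of_squares H" for G H
        using that \<open>\<not> certificate\<close> by (auto simp: certificate_def Istar_eq)
      show "\<exists>r N. 0 < N \<and> ((mvar (Inl k))\<^sup>2 + (mvar (Inr k))\<^sup>2) ^ N - mconst r \<in> ideal_gen S"
        for k using N[of k] unfolding u_def by blast
    qed
    then obtain v where v: "\<And>p. p \<in> ideal_gen S \<Longrightarrow> mpoly_eval v p = 0" by blast
    interpret e: unital_ring_hom "mpoly_eval v" by (rule mpoly_eval_hom)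
    define z where "z = (\<chi> k. Complex (v (Inl k)) (v (Inr k)))"
    have z_nth: "(\<lambda>k. z $ k) = (\<lambda>k. Complex (v (Inl k)) (v (Inr k)))" by (simp add: z_def)
    interpret c: unital_ring_hom "mpoly_eval (\<lambda>k. z $ k)" by (rule mpoly_eval_hom)
    have "mpoly_eval (\<lambda>k. z $ k) (f i) = 0" if "i \<in> {1..r}" for i
    proof -
      have "re_part (f i) \<in> ideal_gen S" "im_part (f i) \<in> ideal_gen S"
        using that by (auto simp: S_def intro!: ideal_gen_base)
      then show ?thesis unfolding z_nth mpoly_eval_re_im_part by (simp add: v complex_eq_iff)
    qed
    then have "z \<in> variety I"
      unfolding variety_def I by (auto intro: c.hom_ideal_gen_zero)
    moreover have "cmod (z $ k) = lam $ k" for k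
    proof -
      \<comment> \<open>Only powers of the squared moduli are prescribed by the ideal; since all
        quantities are nonnegative, the exponent \<open>N k\<close> and then the square can be
        removed.\<close>
      have "((cmod (z $ k))\<^sup>2) ^ N k = ((lam $ k)\<^sup>2) ^ N k"
        using v[OF N(2)[of k]]
        by (simp add: e.hom_diff e.hom_power eval_u mpoly_eval_mconst z_def w_def)
      then have "(cmod (z $ k))\<^sup>2 = (lam $ k)\<^sup>2"
        by (rule power_eq_imp_eq_base) (use N(1) in auto)
      then show ?thesis
        by (rule power_eq_imp_eq_base) (use lam[of k] in auto)
    qed
    then have "lam = (\<chi> k. cmod (z $ k))" by (simp add: vec_eq_iff)
    ultimately show ?thesis unfolding unlog_amoeba_def by blast
  qed
  ultimately show ?thesis by blast
qed

end
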